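(* Let $A\in\mathbb{R}^{n\times n}$ be such that $A-I$ is an irreducible singular $M$-matrix, let $v>0$ satisfy $(A^T-I)v=0$, and let $b\in\mathbb{R}^n$ satisfy $v^Tb=0$. Then every solution of $Ax-|x|=b$ is (componentwise) nonnegative, and there is exactly one solution $\hat{x}$ having at least one zero component. Moreover, for every $x^0\in\mathbb{R}^n$ with $D(x^0)\neq I$ (i.e. $x^0$ has at least one nonpositive component), the generalized Newton method $x^{k+1}=(A-D(x^k))^{-1}b$ is well defined for all $k\ge 0$ and $x^k=\hat{x}$ for all $k\ge n+1$.
   Context: For $x\in\mathbb{R}^n$, $|x|$ is the componentwise absolute value, $\mathrm{sign}(x)$ is the vector whose components are $1,0,-1$ according as the corresponding component of $x$ is positive, zero, negative, and $D(x)=\mathrm{diag}(\mathrm{sign}(x))$. A $Z$-matrix is a real square matrix whose off-diagonal entries are all nonpositive; any $Z$-matrix can be written $sI-B$ with $B\ge 0$ entrywise, and it is a singular $M$-matrix if $s=\rho(B)$, where $\rho$ is spectral radius. A square matrix $M$ is reducible if there is a permutation matrix $P$ with $P^TMP=\begin{bmatrix}M_{11}&M_{12}\\0&M_{22}\end{bmatrix}$ where $M_{11},M_{22}$ are square (nonempty) blocks; it is irreducible otherwise. $v>0$ means all components of $v$ are positive. *)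

theory Defs
  imports "Jordan_Normal_Form.Spectral_Radius" "Jordan_Normal_Form.Gauss_Jordan_Elimination"
begin

definition abs_vec :: "real vec \<Rightarrow> real vec" where
  "abs_vec x = map_vec abs x"

definition sign_diag :: "real vec \<Rightarrow> real mat" where
  "sign_diag x = mat (dim_vec x) (dim_vec x) (\<lambda>(i,j). if i = j then sgn (x $ i) else 0)"

definition Z_matrix :: "real mat \<Rightarrow> bool" where
  "Z_matrix M \<longleftrightarrow> square_mat M \<and>
     (\<forall>i j. i < dim_row M \<and> j < dim_row M \<and> i \<noteq> j \<longrightarrow> M $$ (i,j) \<le> 0)"

definition singular_M_matrix :: "real mat \<Rightarrow> bool" where
  "singular_M_matrix M \<longleftrightarrow> Z_matrix M \<and>
     (\<exists>s B. B \<in> carrier_mat (dim_row M) (dim_row M) \<and>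
            (\<forall>i j. i < dim_row M \<and> j < dim_row M \<longrightarrow> B $$ (i,j) \<ge> 0) \<and>
            M = s \<cdot>\<^sub>m 1\<^sub>m (dim_row M) - B \<and>
            s = spectral_radius (map_mat complex_of_real B))"

definition permutation_matrix :: "nat \<Rightarrow> real mat \<Rightarrow> bool" where
  "permutation_matrix n P \<longleftrightarrow>
     (\<exists>p. p permutes {..<n} \<and> P = mat n n (\<lambda>(i,j). if i = p j then 1 else 0))"

definition reducible :: "real mat \<Rightarrow> bool" where
  "reducible M \<longleftrightarrow> square_mat M \<and>
     (\<exists>P k. permutation_matrix (dim_row M) P \<and> 0 < k \<and> k < dim_row M \<and>
        (\<forall>i j. k \<le> i \<and> i < dim_row M \<and> j < k \<longrightarrow> (transpose_mat P * M * P) $$ (i,j) = 0))"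

definition irreducible_mat :: "real mat \<Rightarrow> bool" where
  "irreducible_mat M \<longleftrightarrow> square_mat M \<and> \<not> reducible M"

text \<open>Generalized Newton iteration x^{k+1} = (A - D(x^k))^{-1} b
  (the value in the non-invertible case is irrelevant; the theorem asserts invertibility).\<close>
primrec newton_iter :: "real mat \<Rightarrow> real vec \<Rightarrow> real vec \<Rightarrow> nat \<Rightarrow> real vec" where
  "newton_iter A b x0 0 = x0"
| "newton_iter A b x0 (Suc k) =
     (case mat_inverse (A - sign_diag (newton_iter A b x0 k)) of
        Some B \<Rightarrow> B *\<^sub>v b
      | None \<Rightarrow> x0)"

end

theory Submission
  imports Defs
begin

text \<open>Write \<open>M = A - I\<close>. Pairing \<open>Mx + (x - \<bar>x\<bar>) = b\<close> with \<open>v\<close> kills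
  \<open>M\<close> and \<open>b\<close>, so \<open>x = \<bar>x\<bar>\<close>. The engine for the rest is a maximum principle: if \<open>E \<ge> 0\<close> is diagonal and
  \<open>(M + E) x \<le> 0\<close>, then \<open>M x\<^sup>+ \<le> 0\<close>, hence \<open>M x\<^sup>+ = 0\<close> by pairing with \<open>v\<close>, and irreducibility
  forces \<open>x\<^sup>+ = 0\<close> or \<open>x > 0\<close>. A Newton step reads \<open>(M + E\<^sub>k) x\<^sup>k\<^sup>+\<^sup>1 = b\<close> with
  \<open>E\<^sub>k = I - D(x\<^sup>k)\<close>; the maximum principle gives invertibility, and monotonicity
  \<open>x\<^sup>k \<le> x\<^sup>k\<^sup>+\<^sup>1\<close> for \<open>k \<ge> 1\<close>. The nonempty sets \<open>N\<^sub>k\<close> of indices of nonpositive components then shrink,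
  and as soon as \<open>N\<^sub>k = N\<^sub>k\<^sub>+\<^sub>1\<close> (for some \<open>1 \<le> k \<le> n\<close>, as \<open>\<bar>N\<^sub>1\<bar> \<le> n\<close>), pairing with \<open>v\<close> shows that \<open>x\<^sup>k\<^sup>+\<^sup>1\<close> vanishes on \<open>N\<^sub>k\<close>, so it is
  the solution with a zero component, a fixed point of the iteration.\<close>

section \<open>Reducibility expressed through index sets\<close>

lemma permutes_image_lessThan_card:
  assumes "S \<subseteq> {..<n::nat}"
  obtains p where "p permutes {..<n}" "p ` {..<card S} = S"
proof -
  let ?k = "card S"
  have fin: "finite S" using assms finite_subset by blast
  have kn: "?k \<le> n" using card_mono[OF _ assms] by simp
  obtain f where f: "bij_betw f {..<?k} S"
    using fin by (metis atLeast0LessThan ex_bij_betw_nat_finite)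
  have "card ({..<n} - S) = card {?k..<n}"
    using assms fin by (simp add: card_Diff_subset)
  then obtain g where g: "bij_betw g {?k..<n} ({..<n} - S)"
    by (metis finite_Diff finite_atLeastLessThan finite_lessThan finite_same_card_bij)
  define p where "p = (\<lambda>i. if i < ?k then f i else if i < n then g i else i)"
  have 1: "bij_betw p {..<?k} S"
    using f by (rule bij_betw_cong[THEN iffD1, rotated]) (simp add: p_def)
  have 2: "bij_betw p {?k..<n} ({..<n} - S)"
    using g by (rule bij_betw_cong[THEN iffD1, rotated]) (simp add: p_def)
  have "bij_betw p ({..<?k} \<union> {?k..<n}) (S \<union> ({..<n} - S))"
    by (rule bij_betw_combine[OF 1 2]) auto
  moreover have "{..<?k} \<union> {?k..<n} = {..<n}" using kn by auto
  moreover have "S \<union> ({..<n} - S) = {..<n}" using assms by auto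
  ultimately have "p permutes {..<n}"
    using kn by (intro bij_imp_permutes) (auto simp: p_def)
  moreover have "p ` {..<?k} = S" using 1 by (simp add: bij_betw_def)
  ultimately show ?thesis by (rule that)
qed

text \<open>Listing the indices of \<open>S\<close> first moves the zero block, with rows outside
  \<open>S\<close> and columns in \<open>S\<close>, to the lower left corner. The size of the
  leading block is \<open>card S\<close>.\<close>

lemma reducibleI:
  assumes M: "M \<in> carrier_mat n n" and S: "S \<subseteq> {..<n}" "S \<noteq> {}" "S \<noteq> {..<n}"
    and zero: "\<And>i j. i < n \<Longrightarrow> i \<notin> S \<Longrightarrow> j \<in> S \<Longrightarrow> M $$ (i,j) = 0"
  shows "reducible M"
proof -
  obtain p where p: "p permutes {..<n}" and pS: "p ` {..<card S} = S"
    using permutes_image_lessThan_card[OF S(1)] .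
  define P :: "real mat" where "P = mat n n (\<lambda>(i,j). if i = p j then 1 else 0)"
  have pn: "p i < n" if "i < n" for i using permutes_in_image[OF p, of i] that by simp
  have k: "0 < card S" "card S < n"
    using S finite_subset[OF S(1)] psubset_card_mono[of "{..<n}" S] by (auto simp: card_gt_0_iff)
  have entry: "(transpose_mat P * M * P) $$ (i,j) = M $$ (p i, p j)" if "i < n" "j < n" for i j
  proof -
    have "(transpose_mat P * M * P) $$ (i,j) =
        (\<Sum>b<n. (\<Sum>a<n. (if a = p i then 1 else 0) * M $$ (a,b)) * (if b = p j then 1 else 0))"
      using that M pn by (simp add: P_def scalar_prod_def atLeast0LessThan)
    also have "\<dots> = M $$ (p i, p j)"
      using that pn by (simp add: if_distrib if_distribR sum.delta cong: if_cong)
    finally show ?thesis .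
  qed
  have "(transpose_mat P * M * P) $$ (i,j) = 0" if "card S \<le> i" "i < n" "j < card S" for i j
  proof -
    have pj: "p j \<in> S" using that(3) pS by blast
    have pi: "p i \<notin> S"
    proof
      assume "p i \<in> S"
      then obtain i' where "i' < card S" "p i = p i'" using pS by force
      with injD[OF permutes_inj[OF p]] that(1) show False by fastforce
    qed
    have "j < n" using that(3) k by linarith
    then show ?thesis using entry[OF that(2)] zero[OF pn[OF that(2)] pi pj] by simp
  qed
  moreover have "permutation_matrix n P" using p by (auto simp: permutation_matrix_def P_def)
  ultimately show ?thesis using M k unfolding reducible_def by auto
qed

section \<open>Irreducible Z-matrices with a positive left null vector\<close>

locale irreducible_Z_matrix =
  fixes n :: nat and M :: "real mat" and v :: "real vec"
  assumes M: "M \<in> carrier_mat n n"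
    and offdiag: "\<And>i j. i < n \<Longrightarrow> j < n \<Longrightarrow> i \<noteq> j \<Longrightarrow> M $$ (i,j) \<le> 0"
    and irreducible: "\<not> reducible M"
    and v: "v \<in> carrier_vec n" and v_pos: "\<And>i. i < n \<Longrightarrow> v $ i > 0"
    and left_null: "transpose_mat M *\<^sub>v v = 0\<^sub>v n"
begin

lemma dim_M [simp]: "dim_row M = n" "dim_col M = n" and dim_v [simp]: "dim_vec v = n"
  using M v by auto

lemma index_mult_M:
  "x \<in> carrier_vec n \<Longrightarrow> i < n \<Longrightarrow> (M *\<^sub>v x) $ i = (\<Sum>j<n. M $$ (i,j) * x $ j)"
  by (auto simp: scalar_prod_def atLeast0LessThan)

text \<open>Moving \<open>M\<close> to the other side of the scalar product produces the null
  vector. Since \<open>v\<close> is positive, an image \<open>M *\<^sub>v x\<close> whose components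
  all have one sign must therefore be zero.\<close>

lemma left_null_mult:
  assumes "x \<in> carrier_vec n"
  shows "(\<Sum>i<n. v $ i * (M *\<^sub>v x) $ i) = 0"
proof -
  have "v \<bullet> (M *\<^sub>v x) = (transpose_mat M *\<^sub>v v) \<bullet> x"
    using transpose_vec_mult_scalar[OF M assms v] assms v M
    by (simp add: comm_scalar_prod)
  then show ?thesis
    using left_null assms by (simp add: scalar_prod_def atLeast0LessThan)
qed

text \<open>Let \<open>?S\<close> be the support of \<open>y\<close>. In a row outside
  \<open>?S\<close> the diagonal term vanishes and all other terms are nonpositive. They sum to
  zero, so each is zero and the row vanishes on \<open>?S\<close>. A proper nonempty support would
  make \<open>M\<close> reducible.\<close>

lemma null_nonneg_cases:
  assumes y: "y \<in> carrier_vec n" and nonneg: "\<And>i. i < n \<Longrightarrow> y $ i \<ge> 0"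
    and null: "\<And>i. i < n \<Longrightarrow> (M *\<^sub>v y) $ i = 0"
  shows "(\<forall>i<n. y $ i = 0) \<or> (\<forall>i<n. y $ i > 0)"
proof (rule ccontr)
  let ?S = "{i. i < n \<and> y $ i > 0}"
  assume "\<not> ?thesis"
  then have ne: "?S \<noteq> {}" "?S \<noteq> {..<n}" using nonneg by force+
  have "M $$ (i,j) = 0" if i: "i < n" "i \<notin> ?S" and j: "j \<in> ?S" for i j
  proof -
    have yi: "y $ i = 0" using i nonneg[of i] by force
    have "M $$ (i,l) * y $ l \<le> 0" if "l < n" for l
      using offdiag[of i l] nonneg[of l] yi i that
      by (cases "l = i") (auto simp: mult_nonpos_nonneg)
    moreover have "(\<Sum>l<n. - (M $$ (i,l) * y $ l)) = 0"
      using null[of i] index_mult_M[OF y, of i] i by (simp add: sum_negf)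
    ultimately have "\<forall>l\<in>{..<n}. - (M $$ (i,l) * y $ l) = 0"
      by (subst sum_nonneg_eq_0_iff[symmetric]) auto
    with j show ?thesis by auto
  qed
  then have "reducible M" using ne by (intro reducibleI[OF M, of ?S]) auto
  with irreducible show False ..
qed

lemma maximum_principle:
  assumes x: "x \<in> carrier_vec n" and e: "\<And>i. i < n \<Longrightarrow> e i \<ge> 0"
    and le: "\<And>i. i < n \<Longrightarrow> (M *\<^sub>v x) $ i + e i * x $ i \<le> 0"
  shows "(\<forall>i<n. x $ i \<le> 0) \<or> (\<forall>i<n. x $ i > 0 \<and> e i = 0)"
proof -
  define y where "y = map_vec (\<lambda>t. max t 0) x"
  have y: "y \<in> carrier_vec n" and yi: "\<And>i. i < n \<Longrightarrow> y $ i = max (x $ i) 0"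
    using x by (auto simp: y_def)
  have My: "(M *\<^sub>v y) $ i \<le> 0" if i: "i < n" for i
  proof (cases "x $ i > 0")
    case True
    \<comment> \<open>Passing from \<open>x\<close> to its positive part \<open>y\<close> leaves
      component \<open>i\<close> alone and can only raise the others, which meet nonpositive
      entries.\<close>
    have "(\<Sum>j<n. M $$ (i,j) * y $ j) \<le> (\<Sum>j<n. M $$ (i,j) * x $ j)"
    proof (rule sum_mono)
      fix j assume "j \<in> {..<n}"
      then show "M $$ (i,j) * y $ j \<le> M $$ (i,j) * x $ j"
        using True offdiag[of i j] i yi[of j]
        by (cases "j = i") (auto intro!: mult_left_mono_neg)
    qed
    moreover have "e i * x $ i \<ge> 0" using e[OF i] True by simp
    ultimately show ?thesis using le[OF i] index_mult_M[OF x i] index_mult_M[OF y i] by linarith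
  next
    case False
    \<comment> \<open>Here \<open>y $ i = 0\<close>, so the diagonal entry, whose sign is not known,
      does not contribute.\<close>
    have "M $$ (i,j) * y $ j \<le> 0" if "j < n" for j
      using False offdiag[of i j] i yi[of j] that
      by (cases "j = i") (auto simp: mult_nonpos_nonneg)
    then show ?thesis unfolding index_mult_M[OF y i] by (auto intro: sum_nonpos)
  qed
  have "\<forall>i\<in>{..<n}. - (v $ i * (M *\<^sub>v y) $ i) = 0"
    using My v_pos left_null_mult[OF y]
    by (subst sum_nonneg_eq_0_iff[symmetric]) (auto simp: sum_negf mult_le_0_iff less_imp_le)
  then have My0: "(M *\<^sub>v y) $ i = 0" if "i < n" for i
    using that v_pos[OF that] by (force simp del: index_mult_mat_vec)
  from null_nonneg_cases[OF y _ My0] yi consider "\<forall>i<n. y $ i = 0" | "\<forall>i<n. y $ i > 0" by auto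
  then show ?thesis
  proof cases
    case 1
    then show ?thesis using yi by (metis max.cobounded1)
  next
    case 2
    have pos: "x $ i > 0" if "i < n" for i using 2 yi that by force
    \<comment> \<open>With \<open>y = x\<close> the vector \<open>x\<close> is itself in the kernel
      of \<open>M\<close>, so the assumed inequality reduces to
      \<open>e i * x $ i \<le> 0\<close>.\<close>
    then have "y = x" using x y yi by (intro eq_vecI) force+
    then have "e i = 0" if "i < n" for i
      using le[OF that] My0[OF that] e[OF that] pos[OF that] by (simp add: mult_le_0_iff)
    with pos show ?thesis by blast
  qed
qed

text \<open>The maximum principle applies to \<open>x - y\<close>; a nonzero entry of
  \<open>e\<close> rules out its strictly positive alternative. Used in both directions, this gives
  uniqueness for the linear systems with matrix \<open>M + diag e\<close>.\<close>

lemma shifted_mono: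
  assumes x: "x \<in> carrier_vec n" and y: "y \<in> carrier_vec n"
    and e: "\<And>i. i < n \<Longrightarrow> e i \<ge> 0" and "\<exists>i<n. e i \<noteq> 0"
    and le: "\<And>i. i < n \<Longrightarrow> (M *\<^sub>v x) $ i + e i * x $ i \<le> (M *\<^sub>v y) $ i + e i * y $ i"
    and "i < n"
  shows "x $ i \<le> y $ i"
proof -
  have "(M *\<^sub>v (x - y)) $ i + e i * (x - y) $ i \<le> 0" if i: "i < n" for i
  proof -
    have "(M *\<^sub>v (x - y)) $ i = (M *\<^sub>v x) $ i - (M *\<^sub>v y) $ i"
      using i by (simp add: mult_minus_distrib_mat_vec[OF M x y] del: index_mult_mat_vec)
    moreover have "e i * (x - y) $ i = e i * x $ i - e i * y $ i"
      using i y by (simp add: right_diff_distrib)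
    ultimately show ?thesis using le[OF i] by linarith
  qed
  with x y have "(\<forall>i<n. (x - y) $ i \<le> 0) \<or> (\<forall>i<n. (x - y) $ i > 0 \<and> e i = 0)"
    by (intro maximum_principle e) auto
  with assms show ?thesis by auto
qed

lemma null_cases:
  assumes x: "x \<in> carrier_vec n" and null: "\<And>i. i < n \<Longrightarrow> (M *\<^sub>v x) $ i = 0"
  shows "(\<forall>i<n. x $ i \<le> 0) \<or> (\<forall>i<n. x $ i > 0)"
  using maximum_principle[OF x, of "\<lambda>_. 0"] null by auto

end

section \<open>Sign matrices and inverses\<close>

lemma sign_diag_neq_one_iff:
  assumes "x \<in> carrier_vec n"
  shows "sign_diag x \<noteq> 1\<^sub>m n \<longleftrightarrow> (\<exists>i<n. x $ i \<le> 0)"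
proof -
  have "sign_diag x = 1\<^sub>m n \<longleftrightarrow> (\<forall>i<n. sgn (x $ i) = 1)"
    using assms by (auto simp: sign_diag_def mat_eq_iff)
  then show ?thesis by (auto simp: sgn_1_pos not_less)
qed

lemma mat_inverse_det_nonzero:
  fixes C :: "'a :: field mat"
  assumes C: "C \<in> carrier_mat n n" and det: "det C \<noteq> 0"
  obtains B where "mat_inverse C = Some B" "B \<in> carrier_mat n n" "C * B = 1\<^sub>m n" "B * C = 1\<^sub>m n"
proof (cases "mat_inverse C")
  case None
  \<comment> \<open>A missing inverse contradicts \<open>C\<close> being a unit of the matrix ring;
    \<open>()\<close> only fills the extension slot of the ring record.\<close>
  with mat_inverse(1)[OF C None, of "()"] det_non_zero_imp_unit[OF C det, of "()"]
  show ?thesis by blast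
next
  case (Some B)
  with mat_inverse(2)[OF C] that show ?thesis by blast
qed

section \<open>Solutions of the absolute value equation\<close>

locale singular_abs_equation = irreducible_Z_matrix n "A - 1\<^sub>m n" v
  for n :: nat and A :: "real mat" and v :: "real vec" +
  fixes b :: "real vec"
  assumes n_pos: "0 < n" and A: "A \<in> carrier_mat n n"
    and b: "b \<in> carrier_vec n" and v_b: "v \<bullet> b = 0"
begin

abbreviation "M \<equiv> A - 1\<^sub>m n"

definition solution :: "real vec \<Rightarrow> bool" where
  "solution x \<longleftrightarrow> x \<in> carrier_vec n \<and> A *\<^sub>v x - abs_vec x = b"

abbreviation nonpos :: "real vec \<Rightarrow> nat set" where
  "nonpos x \<equiv> {i. i < n \<and> x $ i \<le> 0}"

lemma index_A_mult:
  assumes "x \<in> carrier_vec n" "i < n"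
  shows "(A *\<^sub>v x) $ i = (M *\<^sub>v x) $ i + x $ i"
proof -
  have "M *\<^sub>v x = A *\<^sub>v x - x"
    using minus_mult_distrib_mat_vec[OF A one_carrier_mat assms(1)] assms(1) by simp
  then show ?thesis using assms by (simp del: index_mult_mat_vec)
qed

lemma solution_carrier: "solution x \<Longrightarrow> x \<in> carrier_vec n"
  by (simp add: solution_def)

lemma solution_iff:
  "solution x \<longleftrightarrow> x \<in> carrier_vec n \<and> (\<forall>i<n. (M *\<^sub>v x) $ i + (x $ i - \<bar>x $ i\<bar>) = b $ i)"
proof -
  have "(A *\<^sub>v x - abs_vec x) $ i = (M *\<^sub>v x) $ i + (x $ i - \<bar>x $ i\<bar>)"
    if x: "x \<in> carrier_vec n" and i: "i < n" for i
  proof -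
    have "(A *\<^sub>v x - abs_vec x) $ i = (A *\<^sub>v x) $ i - \<bar>x $ i\<bar>"
      using x i by (simp add: abs_vec_def del: index_mult_mat_vec)
    with index_A_mult[OF x i] show ?thesis by linarith
  qed
  moreover have "A *\<^sub>v x - abs_vec x = b \<longleftrightarrow> (\<forall>i<n. (A *\<^sub>v x - abs_vec x) $ i = b $ i)"
    if "x \<in> carrier_vec n"
    using that b by (auto simp: vec_eq_iff abs_vec_def simp del: index_mult_mat_vec index_minus_vec(1))
  ultimately show ?thesis by (auto simp: solution_def simp del: index_mult_mat_vec)
qed

lemma shifted_carrier:
  "x \<in> carrier_vec n \<Longrightarrow> A - sign_diag x \<in> carrier_mat n n"
  by (rule minus_carrier_mat) (simp add: sign_diag_def)

text \<open>Writing \<open>A - D(x)\<close> as \<open>M + (I - D(x))\<close> exhibits it as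
  \<open>M\<close> plus a nonnegative diagonal, the form that \<open>shifted_mono\<close>
  handles.\<close>

lemma index_shifted_mult:
  assumes x: "x \<in> carrier_vec n" and y: "y \<in> carrier_vec n" and i: "i < n"
  shows "((A - sign_diag x) *\<^sub>v y) $ i = (M *\<^sub>v y) $ i + (1 - sgn (x $ i)) * y $ i"
proof -
  have S: "sign_diag x \<in> carrier_mat n n" using x by (simp add: sign_diag_def)
  have "(sign_diag x *\<^sub>v y) $ i = (\<Sum>j<n. (if i = j then sgn (x $ i) * y $ j else 0))"
    using x y i
    by (auto simp: sign_diag_def scalar_prod_def atLeast0LessThan simp del: sum.delta sum.delta'
        intro!: sum.cong)
  also have "\<dots> = sgn (x $ i) * y $ i"
    using i by simp
  finally show ?thesis
    using S y i index_A_mult[OF y i]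
    by (simp add: minus_mult_distrib_mat_vec[OF A S] left_diff_distrib del: index_mult_mat_vec)
qed

lemma weighted_residual_zero:
  assumes x: "x \<in> carrier_vec n" and eq: "\<And>i. i < n \<Longrightarrow> (M *\<^sub>v x) $ i + f i = b $ i"
  shows "(\<Sum>i<n. v $ i * f i) = 0"
proof -
  have "(\<Sum>i<n. v $ i * b $ i) = 0" using v_b b by (simp add: scalar_prod_def atLeast0LessThan)
  moreover have "(\<Sum>i<n. v $ i * b $ i) = (\<Sum>i<n. v $ i * (M *\<^sub>v x) $ i + v $ i * f i)"
    using eq by (intro sum.cong) (auto simp: distrib_left[symmetric] simp del: index_mult_mat_vec)
  ultimately show ?thesis using left_null_mult[OF x] by (simp add: sum.distrib)
qed

text \<open>Both \<open>M *\<^sub>v x\<close> and \<open>b\<close> are orthogonal to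
  \<open>v\<close>, hence so is the residual \<open>f\<close>; orthogonality to a positive vector
  kills a residual of constant sign.\<close>

lemma residual_vanishes:
  assumes x: "x \<in> carrier_vec n" and eq: "\<And>i. i < n \<Longrightarrow> (M *\<^sub>v x) $ i + f i = b $ i"
    and sign: "(\<forall>i<n. f i \<le> 0) \<or> (\<forall>i<n. f i \<ge> 0)" and i: "i < n"
  shows "f i = 0"
proof -
  have *: "g i = 0" if "(\<Sum>i<n. v $ i * g i) = 0" "\<forall>i<n. g i \<ge> 0" for g
  proof -
    have "\<forall>i\<in>{..<n}. v $ i * g i = 0"
      using that v_pos by (subst sum_nonneg_eq_0_iff[symmetric]) (auto simp: less_imp_le)
    with i v_pos[OF i] show ?thesis by force
  qed
  have "(\<Sum>i<n. v $ i * f i) = 0" by (rule weighted_residual_zero[OF x eq])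
  with *[of f] *[of "\<lambda>i. - f i"] sign show ?thesis by (auto simp: sum_negf)
qed

lemma solution_nonneg:
  assumes "solution x" "i < n"
  shows "x $ i \<ge> 0"
proof -
  have "x $ i - \<bar>x $ i\<bar> = 0"
    using assms(1) unfolding solution_iff
    by (intro residual_vanishes[of x "\<lambda>i. x $ i - \<bar>x $ i\<bar>"] assms(2)) auto
  then show ?thesis by simp
qed

lemma solution_M_mult:
  assumes "solution x" "i < n"
  shows "(M *\<^sub>v x) $ i = b $ i"
proof -
  have "(M *\<^sub>v x) $ i + (x $ i - \<bar>x $ i\<bar>) = b $ i"
    using assms unfolding solution_iff by blast
  with solution_nonneg[OF assms] show ?thesis by linarith
qed

text \<open>Solutions are nonnegative, so two of them differ by a null vector of \<open>M\<close>.
  If the difference were positive everywhere, the smaller solution would be negative at a zero of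
  the larger one. Hence each is below the other.\<close>

lemma solution_unique:
  assumes x: "solution x" "\<exists>i<n. x $ i = 0" and y: "solution y" "\<exists>i<n. y $ i = 0"
  shows "x = y"
proof -
  have le: "x' $ i \<le> y' $ i"
    if x': "solution x'" and zero: "\<exists>i<n. x' $ i = 0" and y': "solution y'" and i: "i < n" for x' y' i
  proof -
    note carrier = solution_carrier[OF x'] solution_carrier[OF y']
    have "(M *\<^sub>v (x' - y')) $ i = 0" if "i < n" for i
    proof -
      have "(M *\<^sub>v (x' - y')) $ i = (M *\<^sub>v x' - M *\<^sub>v y') $ i"
        by (subst mult_minus_distrib_mat_vec[OF M carrier]) (rule refl)
      also have "\<dots> = (M *\<^sub>v x') $ i - (M *\<^sub>v y') $ i"
        using that A by (intro index_minus_vec) simp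
      finally show ?thesis
        using solution_M_mult[OF x' that] solution_M_mult[OF y' that] by linarith
    qed
    then have "(\<forall>i<n. (x' - y') $ i \<le> 0) \<or> (\<forall>i<n. (x' - y') $ i > 0)"
      using carrier by (intro null_cases) auto
    then show ?thesis
    proof
      assume pos: "\<forall>i<n. (x' - y') $ i > 0"
      obtain j where "j < n" "x' $ j = 0" using zero by blast
      with pos carrier have "y' $ j < 0" by auto
      with solution_nonneg[OF y' \<open>j < n\<close>] show ?thesis by simp
    qed (use i carrier in auto)
  qed
  show ?thesis
    using solution_carrier[OF x(1)] solution_carrier[OF y(1)] le[OF x y(1)] le[OF y x(1)]
    by (intro eq_vecI) (auto intro: antisym)
qed

lemma one_minus_sgn_nonneg: "0 \<le> 1 - sgn (t :: real)"
  by (simp add: sgn_if)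

text \<open>A nonpositive component of \<open>x\<close> makes the shift nonzero there, so
  \<open>shifted_mono\<close> bounds any kernel vector by zero from above and from below.\<close>

lemma det_shifted:
  assumes x: "x \<in> carrier_vec n" and ne: "nonpos x \<noteq> {}"
  shows "det (A - sign_diag x) \<noteq> 0"
proof -
  have C: "A - sign_diag x \<in> carrier_mat n n" using x by (rule shifted_carrier)
  have e: "\<exists>i<n. 1 - sgn (x $ i) \<noteq> 0" using ne by (force simp: sgn_if)
  have "y = 0\<^sub>v n" if y: "y \<in> carrier_vec n" and null: "(A - sign_diag x) *\<^sub>v y = 0\<^sub>v n" for y
  proof -
    have eq: "(M *\<^sub>v y) $ i + (1 - sgn (x $ i)) * y $ i =
        (M *\<^sub>v 0\<^sub>v n) $ i + (1 - sgn (x $ i)) * 0\<^sub>v n $ i" if "i < n" for i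
    proof -
      have "M *\<^sub>v 0\<^sub>v n = 0\<^sub>v n" using M by auto
      then show ?thesis using index_shifted_mult[OF x y that] that by (simp add: null)
    qed
    have "y $ i \<le> 0\<^sub>v n $ i" "0\<^sub>v n $ i \<le> y $ i" if "i < n" for i
      using shifted_mono[OF y zero_carrier_vec one_minus_sgn_nonneg e eq_refl[OF eq] that]
        shifted_mono[OF zero_carrier_vec y one_minus_sgn_nonneg e eq_refl[OF eq[symmetric]] that]
      by blast+
    with y show ?thesis by (intro eq_vecI antisym) auto
  qed
  with det_0_iff_vec_prod_zero_field[OF C] show ?thesis by blast
qed

lemma invertible_shifted:
  assumes "x \<in> carrier_vec n" "nonpos x \<noteq> {}"
  shows "invertible_mat (A - sign_diag x)"
proof -
  have C: "A - sign_diag x \<in> carrier_mat n n" using assms(1) by (rule shifted_carrier)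
  obtain B where "B \<in> carrier_mat n n" "(A - sign_diag x) * B = 1\<^sub>m n" "B * (A - sign_diag x) = 1\<^sub>m n"
    using mat_inverse_det_nonzero[OF C det_shifted[OF assms]] .
  with C show ?thesis
    unfolding invertible_mat_def inverts_mat_def square_mat.simps by (metis carrier_matD)
qed

section \<open>Finite termination of the generalized Newton method\<close>

declare newton_iter.simps(2) [simp del]

context
  fixes x0 :: "real vec"
  assumes x0: "x0 \<in> carrier_vec n" and nonpos_x0: "nonpos x0 \<noteq> {}"
begin

abbreviation iter :: "nat \<Rightarrow> real vec" where "iter \<equiv> newton_iter A b x0"

abbreviation shift :: "nat \<Rightarrow> nat \<Rightarrow> real" where "shift k i \<equiv> 1 - sgn (iter k $ i)"

text \<open>The third claim carries the induction: a nonpositive component in the new iterate keeps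
  the next matrix invertible, so the \<open>None\<close> branch of the iteration is never
  taken.\<close>

lemma newton_step:
  assumes x: "iter k \<in> carrier_vec n" and ne: "nonpos (iter k) \<noteq> {}"
  shows "iter (Suc k) \<in> carrier_vec n"
    and "i < n \<Longrightarrow> (M *\<^sub>v iter (Suc k)) $ i + shift k i * iter (Suc k) $ i = b $ i"
    and "nonpos (iter (Suc k)) \<noteq> {}"
proof -
  let ?C = "A - sign_diag (iter k)"
  have C: "?C \<in> carrier_mat n n" using x by (rule shifted_carrier)
  obtain B where B: "mat_inverse ?C = Some B" "B \<in> carrier_mat n n" "?C * B = 1\<^sub>m n"
    using mat_inverse_det_nonzero[OF C det_shifted[OF x ne]] .
  have eq: "iter (Suc k) = B *\<^sub>v b" using B by (simp add: newton_iter.simps(2))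
  show y: "iter (Suc k) \<in> carrier_vec n" unfolding eq using B b by simp
  have "?C *\<^sub>v iter (Suc k) = b"
    unfolding eq using B b C by (simp flip: assoc_mult_mat_vec)
  then show step: "(M *\<^sub>v iter (Suc k)) $ i + shift k i * iter (Suc k) $ i = b $ i" if "i < n" for i
    using index_shifted_mult[OF x y that] by simp
  show "nonpos (iter (Suc k)) \<noteq> {}"
  proof
    assume "nonpos (iter (Suc k)) = {}"
    then have pos: "iter (Suc k) $ i > 0" if "i < n" for i using that by (force simp: not_le)
    obtain j where j: "j < n" "iter k $ j \<le> 0" using ne by blast
    \<comment> \<open>A positive new iterate would make every residual nonnegative, hence zero,
      although \<open>shift k j \<ge> 1\<close> at the old nonpositive component
      \<open>j\<close>.\<close>
    have "shift k j * iter (Suc k) $ j = 0"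
      using pos by (intro residual_vanishes[OF y step _ j(1)] disjI2 allI impI mult_nonneg_nonneg
          one_minus_sgn_nonneg less_imp_le)
    with j pos[OF j(1)] show False by (auto simp: sgn_if split: if_splits)
  qed
qed

lemma iter_carrier: "iter k \<in> carrier_vec n" and nonpos_iter: "nonpos (iter k) \<noteq> {}"
proof (induction k)
  case 0
  { case 1 show ?case using x0 by simp next case 2 show ?case using nonpos_x0 by simp }
next
  case (Suc k)
  { case 1 show ?case using newton_step(1) Suc .
  next case 2 show ?case using newton_step(3) Suc . }
qed

lemmas iter_eq = newton_step(2)[OF iter_carrier nonpos_iter]

lemma shift_nonzero: "\<exists>i<n. shift k i \<noteq> 0"
  using nonpos_iter[of k] by (force simp: sgn_if)

lemma iter_Suc_mono:
  assumes i: "i < n"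
  shows "iter (Suc k) $ i \<le> iter (Suc (Suc k)) $ i"
proof (rule shifted_mono[OF iter_carrier iter_carrier one_minus_sgn_nonneg shift_nonzero _ i])
  fix i assume i: "i < n"
  \<comment> \<open>Among all \<open>s\<close> in [-1,1], the sign of \<open>t\<close> minimizes
    \<open>(1 - s) * t\<close>. The current iterate is thus a subsolution of the system defining its
    successor. This needs the current vector to be a Newton iterate, so monotonicity starts at index
    1.\<close>
  have "shift (Suc k) i * iter (Suc k) $ i \<le> shift k i * iter (Suc k) $ i"
    by (cases "iter (Suc k) $ i" "0 :: real" rule: linorder_cases)
      (auto simp: sgn_if)
  then show "(M *\<^sub>v iter (Suc k)) $ i + shift (Suc k) i * iter (Suc k) $ i
      \<le> (M *\<^sub>v iter (Suc (Suc k))) $ i + shift (Suc k) i * iter (Suc (Suc k)) $ i"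
    using iter_eq[OF i, of k] iter_eq[OF i, of "Suc k"] by linarith
qed

lemma nonpos_iter_antimono: "nonpos (iter (Suc (Suc k))) \<subseteq> nonpos (iter (Suc k))"
proof
  fix i assume i: "i \<in> nonpos (iter (Suc (Suc k)))"
  then show "i \<in> nonpos (iter (Suc k))"
    using iter_Suc_mono[of i k] by simp
qed

lemma solution_if_nonpos_stationary:
  assumes "nonpos (iter (Suc k)) = nonpos (iter k)"
  shows "solution (iter (Suc k))" and "\<exists>i<n. iter (Suc k) $ i = 0"
proof -
  let ?y = "iter (Suc k)"
  \<comment> \<open>The shift comes from the old iterate and the sign from the new one. Equality of
    the two index sets aligns them, so all residuals are nonpositive and vanish.\<close>
  have sgn: "shift k i > 0 \<and> ?y $ i \<le> 0 \<or> shift k i = 0 \<and> ?y $ i > 0" if "i < n" for i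
  proof -
    have "?y $ i \<le> 0 \<longleftrightarrow> iter k $ i \<le> 0" using assms that by blast
    then show ?thesis by (cases "iter k $ i" "0 :: real" rule: linorder_cases) auto
  qed
  have zero: "shift k i * ?y $ i = 0" if "i < n" for i
  proof (rule residual_vanishes[where f = "\<lambda>i. shift k i * ?y $ i"])
    show "(\<forall>i<n. shift k i * ?y $ i \<le> 0) \<or> (\<forall>i<n. shift k i * ?y $ i \<ge> 0)"
      using sgn by (force simp: mult_le_0_iff)
  qed (use iter_carrier iter_eq that in blast)+
  have "(M *\<^sub>v ?y) $ i + (?y $ i - \<bar>?y $ i\<bar>) = b $ i" if "i < n" for i
  proof -
    have "?y $ i \<ge> 0" using sgn[OF that] zero[OF that] by auto
    with zero[OF that] iter_eq[OF that, of k] show ?thesis by linarith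
  qed
  then show "solution ?y" unfolding solution_iff using iter_carrier by blast
  obtain i where "i < n" "?y $ i \<le> 0" using nonpos_iter[of "Suc k"] by blast
  with sgn[of i] zero[of i] show "\<exists>i<n. ?y $ i = 0" by auto
qed

text \<open>A solution is nonnegative, so at each index it or its shift is zero. It therefore solves
  the linear system that determines the next iterate, and comparison in both directions gives
  equality.\<close>

lemma iter_Suc_solution:
  assumes "solution (iter k)"
  shows "iter (Suc k) = iter k"
proof -
  let ?x = "iter k" and ?y = "iter (Suc k)"
  have "shift k i * ?x $ i = 0" if "i < n" for i
    using solution_nonneg[OF assms that] by (cases "iter k $ i = 0") (auto simp: sgn_if)
  then have eq: "(M *\<^sub>v ?x) $ i + shift k i * ?x $ i = (M *\<^sub>v ?y) $ i + shift k i * ?y $ i"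
    if "i < n" for i
    using that solution_M_mult[OF assms that] iter_eq[OF that, of k] by simp
  have "?x $ i \<le> ?y $ i" "?y $ i \<le> ?x $ i" if "i < n" for i
    using shifted_mono[OF iter_carrier iter_carrier one_minus_sgn_nonneg shift_nonzero[of k]
        eq_refl[OF eq] that]
      shifted_mono[OF iter_carrier iter_carrier one_minus_sgn_nonneg shift_nonzero[of k]
        eq_refl[OF eq[symmetric]] that]
    by blast+
  then show ?thesis
    using iter_carrier[of k] iter_carrier[of "Suc k"] by (intro eq_vecI antisym) auto
qed

lemma iter_eventually_solution:
  assumes "k \<ge> n + 1"
  shows "solution (iter k)" and "\<exists>i<n. iter k $ i = 0"
proof -
  \<comment> \<open>Otherwise the index sets of iterates 1 to \<open>n + 1\<close> would drop
    strictly \<open>n\<close> times from at most \<open>n\<close> elements, leaving the last one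
    empty. Index 0 is excluded because inclusion holds only from the first iterate on.\<close>
  have "\<exists>k\<le>n. k > 0 \<and> nonpos (iter (Suc k)) = nonpos (iter k)"
  proof (rule ccontr)
    assume "\<not> ?thesis"
    then have neq: "nonpos (iter (Suc k)) \<noteq> nonpos (iter k)" if "0 < k" "k \<le> n" for k
      using that by blast
    have less: "nonpos (iter (Suc (Suc k))) \<subset> nonpos (iter (Suc k))" if "k < n" for k
      by (rule psubsetI[OF nonpos_iter_antimono neq]) (use that in simp_all)
    have "card (nonpos (iter (Suc k))) + k \<le> n" if "k \<le> n" for k
      using that
    proof (induction k)
      case 0
      have "card (nonpos (iter (Suc 0))) \<le> card {..<n}" by (rule card_mono) auto
      then show ?case by simp
    next
      case (Suc k)
      have "card (nonpos (iter (Suc (Suc k)))) < card (nonpos (iter (Suc k)))"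
        using Suc.prems by (intro psubset_card_mono less) auto
      with Suc show ?case by linarith
    qed
    from this[of n] have "card (nonpos (iter (Suc n))) = 0" by linarith
    then have "nonpos (iter (Suc n)) = {}" by (subst (asm) card_0_eq) auto
    with nonpos_iter show False by blast
  qed
  then obtain l where l: "l \<le> n" "nonpos (iter (Suc l)) = nonpos (iter l)" by blast
  have "solution (iter k) \<and> (\<exists>i<n. iter k $ i = 0)" if "k \<ge> Suc l" for k
    using that
  proof (induction k rule: dec_induct)
    case base
    show ?case using solution_if_nonpos_stationary[OF l(2)] by blast
  next
    case (step k)
    then show ?case using iter_Suc_solution[of k] by simp
  qed
  moreover have "k \<ge> Suc l" using l(1) assms by linarith
  ultimately show "solution (iter k)" "\<exists>i<n. iter k $ i = 0" by blast+
qed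

end

end

theorem theorem4p4:
  fixes A :: "real mat" and v b :: "real vec" and n :: nat
  assumes "0 < n"
    and "A \<in> carrier_mat n n"
    and "singular_M_matrix (A - 1\<^sub>m n)"
    and "irreducible_mat (A - 1\<^sub>m n)"
    and "v \<in> carrier_vec n" and "\<forall>i<n. v $ i > 0"
    and "(transpose_mat A - 1\<^sub>m n) *\<^sub>v v = 0\<^sub>v n"
    and "b \<in> carrier_vec n" and "v \<bullet> b = 0"
  shows "(\<forall>x \<in> carrier_vec n. A *\<^sub>v x - abs_vec x = b \<longrightarrow> (\<forall>i<n. x $ i \<ge> 0)) \<and>
         (\<exists>xh \<in> carrier_vec n.
            A *\<^sub>v xh - abs_vec xh = b \<and> (\<exists>i<n. xh $ i = 0) \<and>
            (\<forall>y \<in> carrier_vec n. A *\<^sub>v y - abs_vec y = b \<and> (\<exists>i<n. y $ i = 0) \<longrightarrow> y = xh) \<and>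
            (\<forall>x0 \<in> carrier_vec n. sign_diag x0 \<noteq> 1\<^sub>m n \<longrightarrow>
               (\<forall>k. invertible_mat (A - sign_diag (newton_iter A b x0 k))) \<and>
               (\<forall>k\<ge>n+1. newton_iter A b x0 k = xh)))"
proof -
  interpret singular_abs_equation n A v b
  proof unfold_locales
    show "A - 1\<^sub>m n \<in> carrier_mat n n" by (rule minus_carrier_mat) simp
    show "(A - 1\<^sub>m n) $$ (i, j) \<le> 0" if "i < n" "j < n" "i \<noteq> j" for i j
      using assms(3) that unfolding singular_M_matrix_def Z_matrix_def by simp
    show "\<not> reducible (A - 1\<^sub>m n)" using assms(4) by (simp add: irreducible_mat_def)
    have "transpose_mat (A - 1\<^sub>m n) = transpose_mat A - 1\<^sub>m n"
      using assms(2) by (intro eq_matI) auto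
    then show "transpose_mat (A - 1\<^sub>m n) *\<^sub>v v = 0\<^sub>v n" using assms(7) by simp
  qed (use assms in auto)
  \<comment> \<open>Existence comes from the iteration itself: the zero vector is an admissible
    start, and uniqueness then identifies the limit of every other start with
    \<open>xh\<close>.\<close>
  define xh where "xh = newton_iter A b (0\<^sub>v n) (n + 1)"
  have "nonpos (0\<^sub>v n) \<noteq> {}" using n_pos by auto
  then have xh: "solution xh" "\<exists>i<n. xh $ i = 0"
    unfolding xh_def by (intro iter_eventually_solution; simp)+
  have newton: "(\<forall>k. invertible_mat (A - sign_diag (newton_iter A b x0 k))) \<and>
      (\<forall>k\<ge>n+1. newton_iter A b x0 k = xh)"
    if x0: "x0 \<in> carrier_vec n" "sign_diag x0 \<noteq> 1\<^sub>m n" for x0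
  proof -
    have ne: "nonpos x0 \<noteq> {}" using x0 sign_diag_neq_one_iff by blast
    show ?thesis
      using invertible_shifted[OF iter_carrier[OF x0(1) ne] nonpos_iter[OF x0(1) ne]]
        solution_unique[OF iter_eventually_solution[OF x0(1) ne] xh] by blast
  qed
  show ?thesis
  proof (intro conjI bexI[of _ xh])
    show "\<forall>x \<in> carrier_vec n. A *\<^sub>v x - abs_vec x = b \<longrightarrow> (\<forall>i<n. x $ i \<ge> 0)"
      using solution_nonneg unfolding solution_def by blast
    show "\<forall>y \<in> carrier_vec n. A *\<^sub>v y - abs_vec y = b \<and> (\<exists>i<n. y $ i = 0) \<longrightarrow> y = xh"
      using solution_unique[OF _ _ xh] unfolding solution_def by blast
  qed (use xh newton in \<open>auto simp: solution_def\<close>)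
qed

end
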